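(* Let $R$ be a principal ideal domain and let $F\in \mathrm{VA}_2(R)$ be a coordinate which is a rational length 2 polynomial. Then there exist $d,q_1,q_2\in R\setminus\{0\}$ with $dR+q_2R=R$ and polynomials $Q_1,Q_2\in R[y]$ with $\phi_d(q_2y+Q_2(Q_1(y)))=0$ such that $$F(x,y)=d^{-1}\{q_2y+Q_2(q_1dx+Q_1(y))\},$$ and such that $\phi_{q_1}(F(0,y))\in \mathrm{VA}_1(R/q_1R)$ and $\phi_{q_2}(Q_2(y))\in \mathrm{VA}_1(R/q_2R)$.
   Context: For a commutative ring $S$, $\mathrm{GA}_1(S)$ is the group of automorphisms of the $S$-algebra $S[y]$ and $\mathrm{GA}_2(S)$ is the group of automorphisms of the $S$-algebra $S[x,y]$; $\mathrm{VA}_1(S)=\{P\in S[y] : \exists \sigma\in \mathrm{GA}_1(S),\ \sigma(y)=P\}$ and $\mathrm{VA}_2(S)=\{F\in S[x,y] : \exists \sigma\in \mathrm{GA}_2(S),\ \sigma(y)=F\}$ (coordinates). For $p\in R$, $\phi_p$ denotes the canonical map $R\to R/pR$ extended coefficientwise to polynomials. Let $\mathrm{qt}(R)$ be the field of fractions of $R$. A polynomial $F\in R[x,y]$ is called a rational length 2 polynomial if it can be written as $F(x,y)=p_2y+Q_2(p_1x+Q_1(y))$ with $p_1,p_2\in \mathrm{qt}(R)\setminus\{0\}$, $Q_1,Q_2\in \mathrm{qt}(R)[y]$, $\deg(Q_1)\ge 1$ and $\deg(Q_2)\ge 2$. *)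

theory Defs
  imports
    "HOL-Computational_Algebra.Polynomial_Factorial"
    "HOL-Algebra.Ring_Divisibility"
    "HOL-Algebra.QuotRing"
    "HOL-Algebra.UnivPoly"
    "HOL-Algebra.Algebraic_Closure_Type"
begin

text \<open>
  The base ring is a type \<open>'a :: idom\<close>; \<^const>\<open>ring_of_type_algebra\<close> is that ring as a
  record-based structure with carrier \<^const>\<open>UNIV\<close>. Residue rings are not types, so for them
  we use \<^const>\<open>FactRing\<close> and the univariate polynomial ring \<^const>\<open>UP\<close>.

  \<open>R[x,y]\<close> is represented as \<open>R[y][x]\<close>, i.e. as \<open>'a poly poly\<close> with outer variable \<open>x\<close>
  and inner variable \<open>y\<close>. Hence \<open>F(0,y)\<close> is \<open>poly F 0\<close>.
\<close>

subsection \<open>Coordinates\<close>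

text \<open>Ring automorphisms of \<open>P\<close> fixing \<open>C\<close>, the image of the coefficient ring, pointwise.\<close>

definition alg_aut :: "('p, 'm) ring_scheme \<Rightarrow> 'p set \<Rightarrow> ('p \<Rightarrow> 'p) set" where
  "alg_aut P C = {\<sigma> \<in> ring_iso P P. \<forall>c\<in>C. \<sigma> c = c}"

definition GA1 :: "('s, 'm) ring_scheme \<Rightarrow> ((nat \<Rightarrow> 's) \<Rightarrow> (nat \<Rightarrow> 's)) set" where
  "GA1 S = alg_aut (UP S) {up_ring.monom (UP S) a 0 | a. a \<in> carrier S}"

definition VA1 :: "('s, 'm) ring_scheme \<Rightarrow> (nat \<Rightarrow> 's) set" where
  "VA1 S = {P \<in> carrier (UP S). \<exists>\<sigma>\<in>GA1 S. \<sigma> (up_ring.monom (UP S) \<one>\<^bsub>S\<^esub> 1) = P}"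

definition X2 :: "'a::comm_ring_1 poly poly" where "X2 = [:0, 1:]"

definition Y2 :: "'a::comm_ring_1 poly poly" where "Y2 = [:[:0, 1:]:]"

definition const2 :: "'a::comm_ring_1 \<Rightarrow> 'a poly poly" where "const2 a = [:[:a:]:]"

definition GA2 :: "('a::comm_ring_1 poly poly \<Rightarrow> 'a poly poly) set" where
  "GA2 = alg_aut ring_of_type_algebra (range const2)"

definition VA2 :: "'a::comm_ring_1 poly poly set" where
  "VA2 = {F. \<exists>\<sigma>\<in>GA2. \<sigma> Y2 = F}"

subsection \<open>Residue rings\<close>

definition resring :: "'a::idom \<Rightarrow> 'a set ring" where
  "resring p = ring_of_type_algebra Quot (PIdl\<^bsub>ring_of_type_algebra\<^esub> p)"

definition phi :: "'a::idom \<Rightarrow> 'a poly \<Rightarrow> nat \<Rightarrow> 'a set" where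
  "phi p P = (\<lambda>n. PIdl\<^bsub>ring_of_type_algebra\<^esub> p +>\<^bsub>ring_of_type_algebra\<^esub> poly.coeff P n)"

subsection \<open>Rational length 2 polynomials\<close>

text \<open>\<open>subst2 Q W\<close> is \<open>Q(W)\<close> for \<open>Q\<close> univariate and \<open>W\<close> bivariate.\<close>

definition subst2 :: "'a::comm_ring_1 poly \<Rightarrow> 'a poly poly \<Rightarrow> 'a poly poly" where
  "subst2 Q W = poly (map_poly const2 Q) W"

definition fract2 :: "'a::idom poly poly \<Rightarrow> 'a fract poly poly" where
  "fract2 = map_poly (map_poly to_fract)"

definition rational_length2 :: "'a::idom poly poly \<Rightarrow> bool" where
  "rational_length2 F \<longleftrightarrow>
    (\<exists>(p1 :: 'a fract) (p2 :: 'a fract) (Q1 :: 'a fract poly) (Q2 :: 'a fract poly).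
       p1 \<noteq> 0 \<and> p2 \<noteq> 0 \<and> degree Q1 \<ge> 1 \<and> degree Q2 \<ge> 2 \<and>
       fract2 F = const2 p2 * Y2 + subst2 Q2 (const2 p1 * X2 + subst2 Q1 Y2))"

end

theory Submission
  imports Defs
begin

text \<open>
  After an affine change of the inner variable over the fraction field, clearing denominators and
  dividing by gcds, \<open>d F = q\<^sub>2 y + S(W)\<close> where \<open>W = r x + P(y)\<close> has coprime coefficients, \<open>P(0) = 0\<close>,
  and no prime divides \<open>d\<close>, \<open>q\<^sub>2\<close> and \<open>S\<close>. Modulo any prime \<open>W\<close> is non-constant, so \<open>S(W) \<noteq> 0\<close> unless
  \<open>S = 0\<close>; hence \<open>d\<close> and \<open>q\<^sub>2\<close> are coprime. Comparing the \<open>x\<close>-derivative of \<open>d F\<close> at \<open>x = 0\<close> with the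
  derivative of \<open>d F(0,y)\<close> gives \<open>d | q\<^sub>2 r\<close>, so \<open>r = q\<^sub>1 d\<close>.

  Let \<open>\<tau>\<close> be an automorphism with \<open>\<tau>(F) = y\<close>. Modulo a prime \<open>p\<close> dividing \<open>q\<^sub>1\<close>, \<open>F = f(y)\<close> with
  \<open>f = F(0,y)\<close>, so \<open>f(\<tau>(y)) = y\<close>; modulo a prime dividing \<open>q\<^sub>2\<close>, \<open>S(\<tau>(W)) = d y\<close>. In both cases counting
  degrees first in \<open>x\<close> and then in \<open>y\<close> shows that \<open>f\<close>, respectively \<open>S\<close>, has degree \<open>1\<close> modulo \<open>p\<close>.
  Hence modulo \<open>q\<^sub>1\<close> (respectively \<open>q\<^sub>2\<close>) the linear coefficient is a unit and the higher ones are
  nilpotent, and such a polynomial is a coordinate.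
\<close>

subsection \<open>Principal ideal domains as types\<close>

lemma type_ring_simps [simp]:
  "carrier ring_of_type_algebra = UNIV"
  "x \<otimes>\<^bsub>ring_of_type_algebra\<^esub> y = x * y"
  "x \<oplus>\<^bsub>ring_of_type_algebra\<^esub> y = x + y"
  "\<one>\<^bsub>ring_of_type_algebra\<^esub> = 1"
  "\<zero>\<^bsub>ring_of_type_algebra\<^esub> = 0"
  by (simp_all add: ring_of_type_algebra_def)

lemma type_ring_uminus [simp]:
  "\<ominus>\<^bsub>ring_of_type_algebra\<^esub> x = - (x :: 'a :: comm_ring_1)"
proof -
  interpret R: cring "ring_of_type_algebra :: 'a ring" by (rule cring_from_type_algebra)
  show ?thesis by (rule R.minus_equality) simp_all
qed

lemma type_ring_PIdl [simp]:
  "PIdl\<^bsub>ring_of_type_algebra\<^esub> a = {x. (a :: 'a :: comm_ring_1) dvd x}"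
  by (auto simp: cgenideal_def dvd_def mult.commute)

lemma type_ring_divides [simp]:
  "a divides\<^bsub>ring_of_type_algebra\<^esub> b \<longleftrightarrow> (a :: 'a :: comm_ring_1) dvd b"
  by (auto simp: factor_def dvd_def)

lemma type_ring_Units [simp]:
  "a \<in> Units ring_of_type_algebra \<longleftrightarrow> (a :: 'a :: comm_ring_1) dvd 1"
  by (auto simp: Units_def dvd_def) (metis mult.commute)

lemma type_ring_ring_prime [simp]:
  "ring_prime\<^bsub>ring_of_type_algebra\<^esub> p \<longleftrightarrow> prime_elem (p :: 'a :: idom)"
  by (auto simp: ring_prime_def Divisibility.prime_def prime_elem_def)

lemma type_ring_idealI:
  fixes I :: "'a :: comm_ring_1 set"
  assumes "0 \<in> I" "\<And>x y. x \<in> I \<Longrightarrow> y \<in> I \<Longrightarrow> x + y \<in> I" "\<And>c x. x \<in> I \<Longrightarrow> c * x \<in> I"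
  shows "ideal I ring_of_type_algebra"
proof (rule idealI)
  show "ring (ring_of_type_algebra :: 'a ring)" by (rule ring_from_type_algebra)
  interpret R: cring "ring_of_type_algebra :: 'a ring" by (rule cring_from_type_algebra)
  have inv: "- x \<in> I" if "x \<in> I" for x using assms(3)[OF that, of "-1"] by simp
  show "subgroup I (add_monoid ring_of_type_algebra)"
  proof (rule R.add.subgroupI)
    show "\<ominus>\<^bsub>ring_of_type_algebra\<^esub> x \<in> I" if "x \<in> I" for x using inv[OF that] by simp
  qed (use assms in auto)
qed (use assms in \<open>auto simp: mult.commute\<close>)

section \<open>Ideals, common divisors and saturation in a principal ideal domain\<close>

definition is_pid :: "'a :: idom itself \<Rightarrow> bool" where
  "is_pid _ \<longleftrightarrow> principal_domain (ring_of_type_algebra :: 'a ring)"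

lemma pid_ideal:
  fixes I :: "'a :: idom set"
  assumes "is_pid TYPE('a)"
    and "0 \<in> I" "\<And>x y. x \<in> I \<Longrightarrow> y \<in> I \<Longrightarrow> x + y \<in> I" "\<And>c x. x \<in> I \<Longrightarrow> c * x \<in> I"
  obtains g where "I = {x. g dvd x}"
  using principal_domain.exists_gen[OF assms(1)[unfolded is_pid_def] type_ring_idealI[OF assms(2-4)]]
  by auto

text \<open>The set \<open>A\<close> may be infinite. Here \<open>g\<close> generates the smallest
  ideal containing \<open>A\<close>; the multiples of a common divisor \<open>h\<close> form an
  ideal containing \<open>A\<close>, so \<open>h\<close> divides \<open>g\<close>.\<close>

lemma pid_gcd:
  fixes A :: "'a :: idom set"
  assumes "is_pid TYPE('a)"
  obtains g where "\<And>a. a \<in> A \<Longrightarrow> g dvd a" "\<And>h. (\<And>a. a \<in> A \<Longrightarrow> h dvd a) \<Longrightarrow> h dvd g"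
proof -
  define ideals where "ideals = {J :: 'a set. A \<subseteq> J \<and> 0 \<in> J \<and> (\<forall>x\<in>J. \<forall>y\<in>J. x + y \<in> J) \<and>
    (\<forall>x\<in>J. \<forall>c. c * x \<in> J)}"
  obtain g where g: "\<Inter>ideals = {x. g dvd x}"
    by (rule pid_ideal[OF assms, of "\<Inter>ideals"]) (auto simp: ideals_def)
  show thesis
  proof
    show "g dvd a" if "a \<in> A" for a
      using g that by (auto simp: ideals_def)
    show "h dvd g" if "\<And>a. a \<in> A \<Longrightarrow> h dvd a" for h
    proof -
      have "{x. h dvd x} \<in> ideals" using that by (auto simp: ideals_def)
      then show ?thesis using g by (metis InterD dvd_refl mem_Collect_eq)
    qed
  qed
qed

lemma pid_prime_divisor:
  fixes a :: "'a :: idom"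
  assumes pid: "is_pid TYPE('a)" and "a \<noteq> 0" "\<not> a dvd 1"
  obtains p where "prime_elem p" "p dvd a"
proof -
  interpret R: principal_domain "ring_of_type_algebra :: 'a ring"
    using pid by (simp add: is_pid_def)
  obtain b where "ring_irreducible\<^bsub>ring_of_type_algebra\<^esub> b" "b divides\<^bsub>ring_of_type_algebra\<^esub> a"
    using R.exists_irreducible_divisor[of a] assms by auto
  then show thesis using R.primeness_condition[of b] that by simp
qed

text \<open>A generator of the ideal spanned by \<open>a\<close> and \<open>b\<close> divides both.
  It is nonzero because \<open>a\<close> is, so if it were not a unit it would have a prime divisor
  common to \<open>a\<close> and \<open>b\<close>.\<close>

lemma pid_bezout:
  fixes a b :: "'a :: idom"
  assumes pid: "is_pid TYPE('a)" and "a \<noteq> 0"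
    and "\<And>p. prime_elem p \<Longrightarrow> p dvd a \<Longrightarrow> p dvd b \<Longrightarrow> False"
  obtains u v where "a * u + b * v = 1"
proof -
  obtain g where g: "{a * u + b * v | u v. True} = {x. g dvd x}"
  proof (rule pid_ideal[OF pid, of "{a * u + b * v | u v. True}"])
    show "0 \<in> {a * u + b * v | u v. True}" by (auto intro!: exI[of _ 0])
    show "x + y \<in> {a * u + b * v | u v. True}"
      if xy: "x \<in> {a * u + b * v | u v. True}" "y \<in> {a * u + b * v | u v. True}" for x y
    proof -
      obtain u v u' v' where "x = a * u + b * v" "y = a * u' + b * v'" using xy by auto
      then have "x + y = a * (u + u') + b * (v + v')" by (simp add: algebra_simps)
      then show ?thesis by blast
    qed
    show "c * x \<in> {a * u + b * v | u v. True}" if x: "x \<in> {a * u + b * v | u v. True}" for c x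
    proof -
      obtain u v where "x = a * u + b * v" using x by blast
      then have "c * x = a * (c * u) + b * (c * v)" by (simp add: algebra_simps)
      then show ?thesis by blast
    qed
  qed
  have "a = a * 1 + b * 0" "b = a * 0 + b * 1" by simp_all
  then have "g dvd a" "g dvd b" using g by blast+
  then have "g dvd 1"
    using pid_prime_divisor[OF pid, of g] assms(2,3) by (metis dvd_0_left dvd_trans)
  then have "1 \<in> {a * u + b * v | u v. True}" using g by simp
  then show thesis using that by auto
qed

text \<open>Factorization is avoided by saturating: \<open>I\<close> collects the \<open>x\<close>
  for which \<open>q\<close> divides \<open>x\<close> times a power of \<open>n\<close>. If its
  generator were not a unit, a prime factor of it would divide \<open>n\<close> and could be removed
  without leaving \<open>I\<close>.\<close>

lemma pid_dvd_power:
  fixes q n :: "'a :: idom"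
  assumes pid: "is_pid TYPE('a)" and "q \<noteq> 0"
    and prime: "\<And>p. prime_elem p \<Longrightarrow> p dvd q \<Longrightarrow> p dvd n"
  obtains m where "q dvd n ^ m"
proof -
  define I where "I = {x. \<exists>m. q dvd x * n ^ m}"
  obtain g where g: "I = {x. g dvd x}"
  proof (rule pid_ideal[OF pid, of I])
    show "0 \<in> I" by (simp add: I_def)
    show "x + y \<in> I" if "x \<in> I" "y \<in> I" for x y
    proof -
      obtain k l where kl: "q dvd x * n ^ k" "q dvd y * n ^ l" using \<open>x \<in> I\<close> \<open>y \<in> I\<close>
        by (auto simp: I_def)
      have "q dvd (x * n ^ k) * n ^ l + (y * n ^ l) * n ^ k" using kl by simp
      also have "\<dots> = (x + y) * n ^ (k + l)" by (simp add: algebra_simps power_add)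
      finally show ?thesis by (auto simp: I_def)
    qed
    show "c * x \<in> I" if "x \<in> I" for c x using that by (auto simp: I_def mult.assoc intro: dvd_mult)
  qed
  have "g dvd 1"
  proof (rule ccontr)
    assume "\<not> g dvd 1"
    have "q \<in> I" by (auto simp: I_def)
    then have "g dvd q" using g by simp
    then have "g \<noteq> 0" using \<open>q \<noteq> 0\<close> by auto
    obtain p where p: "prime_elem p" "p dvd g"
      using pid_prime_divisor[OF pid \<open>g \<noteq> 0\<close> \<open>\<not> g dvd 1\<close>] .
    then have "p dvd n" using prime \<open>g dvd q\<close> dvd_trans by blast
    then obtain c where c: "n = p * c" by blast
    obtain h where h: "g = p * h" using p(2) by blast
    have "g \<in> I" using g by simp
    then obtain m where "q dvd g * n ^ m" by (auto simp: I_def)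
    then have "q dvd (g * n ^ m) * c" by simp
    \<comment> \<open>One more power of \<open>n\<close> absorbs the prime \<open>p\<close> removed
      from \<open>g\<close>.\<close>
    also have "(g * n ^ m) * c = h * n ^ Suc m" by (simp add: h c mult_ac)
    finally have "h \<in> I" unfolding I_def by blast
    then have "p * h dvd 1 * h" using g h by simp
    moreover have "h \<noteq> 0" using h \<open>g \<noteq> 0\<close> by auto
    ultimately have "p dvd 1" by (simp only: dvd_mult_cancel_right) simp
    then show False using p(1) by (simp add: prime_elem_def)
  qed
  then have "1 \<in> I" using g by simp
  then show thesis using that by (auto simp: I_def)
qed

subsection \<open>Congruences under composition\<close>

lemma poly_diff_dvd: "x - y dvd poly p x - poly p (y :: 'a :: comm_ring_1)"
proof (induction p)
  case (pCons a p)
  have "poly (pCons a p) x - poly (pCons a p) y = x * (poly p x - poly p y) + (x - y) * poly p y"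
    by (simp add: algebra_simps)
  then show ?case using pCons.IH by simp
qed simp

lemma pcompose_cong_right:
  "c dvd g - h \<Longrightarrow> c dvd pcompose f g - pcompose f (h :: 'a :: comm_ring_1 poly)"
  unfolding pcompose_altdef by (rule dvd_trans[OF _ poly_diff_dvd])

lemma pcompose_cong_left:
  assumes "[:q:] dvd f - g"
  shows "[:q:] dvd pcompose f h - pcompose g (h :: 'a :: comm_ring_1 poly)"
proof -
  obtain k where "f - g = [:q:] * k" using assms by blast
  then have "pcompose f h - pcompose g h = [:q:] * pcompose k h"
    by (metis pcompose_diff pcompose_mult pcompose_const)
  then show ?thesis by (simp only: dvd_triv_left)
qed

lemma cong_trans: "(c :: 'a :: comm_ring_1) dvd x - y \<Longrightarrow> c dvd y - z \<Longrightarrow> c dvd x - z"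
  using dvd_add[of c "x - y" "y - z"] by simp

lemma cong_sym: "(c :: 'a :: comm_ring_1) dvd x - y \<Longrightarrow> c dvd y - x"
  using dvd_minus_iff[of c "x - y"] by simp

subsection \<open>Residue rings and their polynomial rings\<close>

context
  fixes q :: "'a :: idom"
begin

interpretation R: cring "ring_of_type_algebra :: 'a ring" by (rule cring_from_type_algebra)
interpretation I: ideal "PIdl\<^bsub>ring_of_type_algebra\<^esub> q" ring_of_type_algebra
  by (rule R.cgenideal_ideal) simp

definition residue :: "'a \<Rightarrow> 'a set" where
  "residue a = PIdl\<^bsub>ring_of_type_algebra\<^esub> q +>\<^bsub>ring_of_type_algebra\<^esub> a"

interpretation A: cring "resring q"
  unfolding resring_def by (rule I.quotient_is_cring) (rule cring_from_type_algebra)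

interpretation residue_hom: ring_hom_cring ring_of_type_algebra "resring q" residue
  unfolding resring_def residue_def [abs_def]
  by (rule I.rcos_ring_hom_cring) (rule cring_from_type_algebra)

lemma carrier_resring: "carrier (resring q) = range residue"
  by (auto simp: resring_def residue_def FactRing_def A_RCOSETS_def')

lemma residue_eq_iff: "residue a = residue b \<longleftrightarrow> q dvd a - b"
  using R.quotient_eq_iff_same_a_r_cos[OF I.is_ideal, of a b]
  by (simp add: residue_def a_minus_def)

lemma phi_apply: "phi q P n = residue (poly.coeff P n)"
  by (simp add: phi_def residue_def)

lemma residue_0 [simp]: "residue 0 = \<zero>\<^bsub>resring q\<^esub>" using residue_hom.hom_zero by simp

lemma residue_1 [simp]: "residue 1 = \<one>\<^bsub>resring q\<^esub>" using residue_hom.hom_one by simp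

lemma residue_in_carrier [simp]: "residue a \<in> carrier (resring q)"
  by (simp add: carrier_resring)

text \<open>Equality over the residue ring becomes a congruence between representatives, the form in
  which the later arguments work.\<close>

lemma phi_eq_iff: "phi q P = phi q Q \<longleftrightarrow> [:q:] dvd P - Q"
  by (simp add: fun_eq_iff phi_apply residue_eq_iff const_poly_dvd_iff)

lemma phi_in_carrier [simp]: "phi q P \<in> carrier (UP (resring q))"
proof -
  have "phi q P \<in> up (resring q)"
  proof (rule mem_upI)
    show "\<exists>n. bound \<zero>\<^bsub>resring q\<^esub> n (phi q P)"
      by (rule exI[of _ "degree P"]) (auto simp: phi_apply coeff_eq_0)
  qed (simp add: phi_apply)
  then show ?thesis by (simp add: UP_def)
qed

lemma phi_surj:
  assumes "u \<in> carrier (UP (resring q))"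
  obtains P where "u = phi q P"
proof -
  have u: "u n \<in> range residue" for n
    using assms by (auto simp: UP_def carrier_resring[symmetric])
  then have "\<forall>n. \<exists>a. u n = residue a" by blast
  then obtain r where r: "\<And>n. u n = residue (r n)" by metis
  obtain N where N: "bound \<zero>\<^bsub>resring q\<^esub> N u" using assms by (auto simp: UP_def up_def)
  define P where "P = (\<Sum>i\<le>N. Polynomial.monom (r i) i)"
  have "poly.coeff P n = (if n \<le> N then r n else 0)" for n
    by (simp add: P_def coeff_sum)
  then have "u n = phi q P n" for n
    using bound.bound[OF N, of n] r by (auto simp: phi_apply)
  then show thesis using that by blast
qed

lemma finsum_residue:
  "(\<Oplus>\<^bsub>resring q\<^esub>i\<in>{..n::nat}. residue (h i)) = residue (\<Sum>i\<le>n. h i)"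
proof (induction n)
  case (Suc n)
  have "(\<Oplus>\<^bsub>resring q\<^esub>i\<in>{..Suc n}. residue (h i)) =
      residue (h (Suc n)) \<oplus>\<^bsub>resring q\<^esub> residue (\<Sum>i\<le>n. h i)"
    using Suc.IH by (simp add: atMost_Suc A.finsum_insert)
  also have "\<dots> = residue (h (Suc n) + (\<Sum>i\<le>n. h i))"
    using residue_hom.hom_add by (metis UNIV_I type_ring_simps(1,3))
  finally show ?case by (simp add: add.commute)
qed simp

lemma phi_add: "phi q (P + Q) = phi q P \<oplus>\<^bsub>UP (resring q)\<^esub> phi q Q"
proof -
  have "residue (a + b) = residue a \<oplus>\<^bsub>resring q\<^esub> residue b" for a b
    using residue_hom.hom_add by (metis UNIV_I type_ring_simps(1,3))
  then show ?thesis
    using phi_in_carrier[of P] phi_in_carrier[of Q] by (simp add: UP_def fun_eq_iff phi_apply)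
qed

lemma phi_mult: "phi q (P * Q) = phi q P \<otimes>\<^bsub>UP (resring q)\<^esub> phi q Q"
proof -
  have "residue a \<otimes>\<^bsub>resring q\<^esub> residue b = residue (a * b)" for a b
    using residue_hom.hom_mult by (metis UNIV_I type_ring_simps(1,2))
  then show ?thesis
    using phi_in_carrier[of P] phi_in_carrier[of Q]
    by (simp add: UP_def fun_eq_iff phi_apply coeff_mult finsum_residue)
qed

lemma phi_0: "phi q 0 = \<zero>\<^bsub>UP (resring q)\<^esub>"
  by (simp add: UP_def fun_eq_iff phi_apply)

lemma phi_1: "phi q 1 = \<one>\<^bsub>UP (resring q)\<^esub>"
  by (auto simp: UP_def fun_eq_iff phi_apply one_pCons coeff_pCons split: nat.splits)

lemma phi_monom: "up_ring.monom (UP (resring q)) (residue a) n = phi q (Polynomial.monom a n)"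
  by (auto simp: UP_def fun_eq_iff phi_apply)

text \<open>Substituting \<open>f\<close> for the variable is an automorphism over the residue ring,
  because substituting \<open>g\<close> undoes it on both sides.\<close>

lemma phi_in_VA1:
  assumes fg: "[:q:] dvd pcompose f g - [:0, 1:]" and gf: "[:q:] dvd pcompose g f - [:0, 1:]"
  shows "phi q f \<in> VA1 (resring q)"
proof -
  let ?U = "UP (resring q)"
  \<comment> \<open>\<open>lift h\<close> substitutes \<open>h\<close> into an arbitrary
    representative of \<open>u\<close>; the choice does not matter because composition respects
    congruences.\<close>
  define lift where "lift h u = phi q (pcompose (SOME P. u = phi q P) h)" for h u
  have lift: "lift h (phi q P) = phi q (pcompose P h)" for h P
  proof -
    have "phi q P = phi q (SOME P'. phi q P = phi q P')" by (rule someI[of _ P]) simp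
    then have "[:q:] dvd (SOME P'. phi q P = phi q P') - P" by (metis phi_eq_iff)
    then show ?thesis unfolding lift_def phi_eq_iff by (rule pcompose_cong_left)
  qed
  have lift_carrier: "lift h u \<in> carrier ?U" for h u by (simp add: lift_def)
  have lift_hom: "lift h \<in> ring_hom ?U ?U" for h
  proof (rule ring_hom_memI)
    fix u v assume "u \<in> carrier ?U" "v \<in> carrier ?U"
    then obtain P Q where uv: "u = phi q P" "v = phi q Q" by (metis phi_surj)
    show "lift h (u \<otimes>\<^bsub>?U\<^esub> v) = lift h u \<otimes>\<^bsub>?U\<^esub> lift h v"
      by (simp add: uv lift pcompose_mult flip: phi_mult)
    show "lift h (u \<oplus>\<^bsub>?U\<^esub> v) = lift h u \<oplus>\<^bsub>?U\<^esub> lift h v"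
      by (simp add: uv lift pcompose_add flip: phi_add)
  next
    show "lift h \<one>\<^bsub>?U\<^esub> = \<one>\<^bsub>?U\<^esub>" by (simp add: lift pcompose_1 flip: phi_1)
  qed (rule lift_carrier)
  have inverse: "lift h (lift k u) = u"
    if "[:q:] dvd pcompose k h - [:0, 1:]" "u \<in> carrier ?U" for h k u
  proof -
    obtain P where "u = phi q P" using phi_surj \<open>u \<in> carrier ?U\<close> .
    then show ?thesis
      using pcompose_cong_right[OF that(1), of P] by (simp add: lift phi_eq_iff pcompose_assoc)
  qed
  have "bij_betw (lift f) (carrier ?U) (carrier ?U)"
    by (rule bij_betwI[where g = "lift g"]) (auto simp: lift_carrier inverse fg gf)
  then have "lift f \<in> ring_iso ?U ?U" using lift_hom by (simp add: ring_iso_def)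
  moreover have "lift f (up_ring.monom ?U a 0) = up_ring.monom ?U a 0"
    if "a \<in> carrier (resring q)" for a
    using that by (auto simp: carrier_resring phi_monom lift monom_0)
  ultimately have "lift f \<in> GA1 (resring q)" by (auto simp: GA1_def alg_aut_def)
  moreover have "lift f (up_ring.monom ?U \<one>\<^bsub>resring q\<^esub> 1) = phi q f"
    using phi_monom[of 1 1] by (simp add: lift monom_altdef pcompose_pCons)
  ultimately show ?thesis by (auto simp: VA1_def)
qed

end

subsection \<open>Univariate coordinates over residue rings\<close>

text \<open>Newton-type iteration: replacing \<open>f\<close> by \<open>(2y - f) \<circ> f\<close> doubles the order of \<open>f - y\<close>
  in powers of \<open>n\<close>.\<close>

lemma unipotent_left_inverse:
  fixes f :: "'a :: idom poly"
  assumes "[:n ^ k:] dvd f - [:0, 1:]" "k \<ge> 1"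
  obtains g where "[:n ^ m:] dvd pcompose g f - [:0, 1:]" "[:n:] dvd g - [:0, 1:]"
proof -
  have "\<exists>g. [:n ^ m:] dvd pcompose g f - [:0, 1:] \<and> [:n:] dvd g - [:0, 1:]"
    using assms
  proof (induction "m - k" arbitrary: f k)
    case 0
    then have "[:n ^ m:] dvd [:n ^ k:]" by (simp add: le_imp_power_dvd)
    then have "[:n ^ m:] dvd pcompose [:0, 1:] f - [:0, 1:]"
      using 0(2) dvd_trans by (simp add: pcompose_pCons del: const_poly_dvd_const_poly_iff) blast
    then show ?case by (intro exI[of _ "[:0, 1:]"]) simp
  next
    case (Suc l)
    let ?X = "[:0, 1:] :: 'a poly"
    obtain D where D: "f - ?X = [:n ^ k:] * D" using Suc(3) by blast
    \<comment> \<open>This is \<open>2y - f\<close>. The error of \<open>h(f)\<close> is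
      \<open>n ^ k\<close> times \<open>D(y) - D(f)\<close>, and the second factor is divisible by
      \<open>y - f\<close>, hence again by \<open>n ^ k\<close>.\<close>
    define h where "h = ?X - [:n ^ k:] * D"
    have "pcompose h f = f - [:n ^ k:] * pcompose D f"
      unfolding h_def pcompose_diff pcompose_mult pcompose_const by (simp add: pcompose_pCons)
    then have "pcompose h f - ?X = [:n ^ k:] * (pcompose D ?X - pcompose D f)"
      using D by (simp add: algebra_simps)
    moreover have "[:n ^ k:] dvd pcompose D ?X - pcompose D f"
      by (rule pcompose_cong_right) (rule cong_sym[OF Suc(3)])
    ultimately have "[:n ^ k:] * [:n ^ k:] dvd pcompose h f - ?X"
      by (simp only: mult_dvd_mono dvd_refl)
    \<comment> \<open>The induction uses only the gain of one power, for which
      \<open>k \<ge> 1\<close> suffices.\<close>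
    moreover have "[:n ^ Suc k:] dvd [:n ^ k:] * [:n ^ k:]"
    proof -
      have "n ^ Suc k dvd n ^ (k + k)" by (rule le_imp_power_dvd) (use Suc.prems(2) in simp)
      then show ?thesis by (simp add: power_add)
    qed
    ultimately have "[:n ^ Suc k:] dvd pcompose h f - ?X" using dvd_trans by blast
    moreover have "l = m - Suc k" using Suc(2) by simp
    ultimately obtain g where g: "[:n ^ m:] dvd pcompose g (pcompose h f) - ?X" "[:n:] dvd g - ?X"
      using Suc(1)[of "Suc k" "pcompose h f"] by auto
    have "[:n:] dvd [:n ^ k:]"
      using Suc.prems(2) by (simp add: dvd_power)
    moreover have "h - ?X = [:n ^ k:] * (- D)" by (simp add: h_def)
    ultimately have "[:n:] dvd h - ?X" by (simp only: dvd_mult2)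
    moreover have "[:n:] dvd pcompose g h - pcompose ?X h" using g(2) by (rule pcompose_cong_left)
    ultimately have "[:n:] dvd pcompose g h - ?X"
      by - (rule cong_trans[of _ "pcompose g h" h], simp_all add: pcompose_pCons)
    then show ?case using g(1) by (intro exI[of _ "pcompose g h"]) (simp add: pcompose_assoc)
  qed
  then show thesis using that by blast
qed

text \<open>The left inverse \<open>g\<close> is again congruent to \<open>y\<close> modulo
  \<open>n\<close>, so it has a left inverse \<open>e\<close> of its own. As in a group,
  \<open>f(g) = e(g(f(g))) = e(g) = y\<close> modulo \<open>n ^ m\<close>.\<close>

lemma unipotent_inverse:
  fixes f :: "'a :: idom poly"
  assumes "[:n:] dvd f - [:0, 1:]"
  obtains g where "[:n ^ m:] dvd pcompose g f - [:0, 1:]" "[:n ^ m:] dvd pcompose f g - [:0, 1:]"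
proof -
  let ?X = "[:0, 1:] :: 'a poly"
  have idL: "pcompose ?X h = h" for h :: "'a poly" by (simp add: pcompose_pCons)
  obtain g where g: "[:n ^ m:] dvd pcompose g f - ?X" "[:n:] dvd g - ?X"
    using unipotent_left_inverse[of n 1 f m] assms by auto
  obtain e where e: "[:n ^ m:] dvd pcompose e g - ?X"
    using unipotent_left_inverse[of n 1 g m] g(2) by auto
  have "[:n ^ m:] dvd pcompose f g - pcompose (pcompose e g) (pcompose f g)"
    using cong_sym[OF pcompose_cong_left[OF e, of "pcompose f g"]] unfolding idL .
  moreover have "[:n ^ m:] dvd pcompose (pcompose e (pcompose g f)) g - pcompose e g"
    using pcompose_cong_left[OF pcompose_cong_right[OF g(1), of e], of g] by simp
  ultimately have "[:n ^ m:] dvd pcompose f g - pcompose e g"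
    by - (rule cong_trans[of _ "pcompose f g" "pcompose (pcompose e (pcompose g f)) g"],
      simp_all add: pcompose_assoc)
  then have "[:n ^ m:] dvd pcompose f g - ?X" using e by (rule cong_trans)
  then show thesis using that g(1) by blast
qed

text \<open>Removing the constant term and scaling by \<open>v\<close> makes \<open>f\<close>
  congruent to \<open>y\<close> modulo \<open>n\<close>. The result is invertible modulo
  \<open>n ^ m\<close>, hence modulo \<open>q\<close>, and the affine normalization is invertible
  modulo \<open>q\<close> as well.\<close>

lemma unit_nilpotent_VA1:
  fixes f :: "'a :: idom poly"
  assumes v: "q dvd v * poly.coeff f 1 - 1" and n: "n dvd q" "q dvd n ^ m"
    and nil: "\<And>k. k \<ge> 2 \<Longrightarrow> n dvd poly.coeff f k"
  shows "phi q f \<in> VA1 (resring q)"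
proof -
  let ?X = "[:0, 1:] :: 'a poly"
  define a u where "a = poly.coeff f 0" and "u = poly.coeff f 1"
  define f0 where "f0 = [:v:] * (f - [:a:])"
  \<comment> \<open>\<open>L(f)\<close> is exactly \<open>f0\<close>, while \<open>L'\<close>
    inverts \<open>L\<close> only modulo \<open>q\<close>. The inverse of \<open>f\<close> will be
    \<open>g0(L)\<close>.\<close>
  define L where "L = [:- v * a, v:]"
  define L' where "L' = [:a, u:]"
  have "n dvd poly.coeff (f0 - ?X) k" for k
  proof -
    consider "k = 0" | "k = 1" | "k \<ge> 2" by linarith
    then show ?thesis
    proof cases
      case 2
      then show ?thesis using dvd_trans[OF n(1) v] by (simp add: f0_def)
    next
      case 3
      then obtain l where "k = Suc (Suc l)" by (metis Suc_le_D numeral_2_eq_2 Suc_le_mono)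
      then show ?thesis using nil[OF 3] by (simp add: f0_def)
    qed (simp add: f0_def a_def)
  qed
  then have "[:n:] dvd f0 - ?X" by (simp only: const_poly_dvd_iff) blast
  then obtain g0 where "[:n ^ m:] dvd pcompose g0 f0 - ?X" "[:n ^ m:] dvd pcompose f0 g0 - ?X"
    using unipotent_inverse by blast
  moreover have "[:q:] dvd [:n ^ m:]" using n(2) by simp
  ultimately have g0: "[:q:] dvd pcompose g0 f0 - ?X" "[:q:] dvd pcompose f0 g0 - ?X"
    using dvd_trans by blast+
  have uv: "q dvd u * v - 1" using v by (simp add: u_def mult.commute)
  show ?thesis
  proof (rule phi_in_VA1)
    have "pcompose L f = f0" by (simp add: L_def f0_def pcompose_pCons algebra_simps)
    then show "[:q:] dvd pcompose (pcompose g0 L) f - ?X"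
      using g0(1) by (simp add: pcompose_assoc[symmetric])
    have "f - pcompose L' f0 = [:1 - u * v:] * (f - [:a:])"
      by (simp add: L'_def f0_def pcompose_pCons algebra_simps one_pCons smult_diff_left smult_diff_right)
    moreover have "[:q:] dvd [:1 - u * v:]"
      using cong_sym[OF uv] by simp
    ultimately have "[:q:] dvd f - pcompose L' f0" by (simp only: dvd_mult2)
    from pcompose_cong_left[OF this, of "pcompose g0 L"]
    have "[:q:] dvd pcompose f (pcompose g0 L) - pcompose L' (pcompose (pcompose f0 g0) L)"
      by (simp add: pcompose_assoc)
    moreover have "[:q:] dvd pcompose L' (pcompose (pcompose f0 g0) L) - pcompose L' (pcompose ?X L)"
      by (intro pcompose_cong_right pcompose_cong_left g0)
    moreover have "pcompose L' (pcompose ?X L) - ?X = [:u * v - 1:] * [:-a, 1:]"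
      by (simp add: L'_def L_def pcompose_pCons algebra_simps)
    then have "[:q:] dvd pcompose L' (pcompose ?X L) - ?X"
      using uv by (simp only: dvd_mult2 const_poly_dvd_const_poly_iff)
    ultimately show "[:q:] dvd pcompose f (pcompose g0 L) - ?X" by (meson cong_trans)
  qed
qed

text \<open>Bezout gives an inverse of the linear coefficient modulo \<open>q\<close>. For
  nilpotency, \<open>n\<close> is the gcd of \<open>q\<close> and all higher coefficients; every
  prime divisor of \<open>q\<close> divides it, so \<open>q\<close> divides a power of
  \<open>n\<close>.\<close>

lemma VA1_of_prime_coeffs:
  fixes f :: "'a :: idom poly"
  assumes pid: "is_pid TYPE('a)" and "q \<noteq> 0"
    and unit: "\<And>p. prime_elem p \<Longrightarrow> p dvd q \<Longrightarrow> \<not> p dvd poly.coeff f 1"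
    and nil: "\<And>p k. prime_elem p \<Longrightarrow> p dvd q \<Longrightarrow> k \<ge> 2 \<Longrightarrow> p dvd poly.coeff f k"
  shows "phi q f \<in> VA1 (resring q)"
proof -
  obtain w v where "q * w + poly.coeff f 1 * v = 1"
    using pid_bezout[OF pid \<open>q \<noteq> 0\<close>] unit by blast
  then have "v * poly.coeff f 1 - 1 = q * (- w)" by (simp add: algebra_simps)
  then have v: "q dvd v * poly.coeff f 1 - 1" by (metis dvd_triv_left)
  obtain n where n: "\<And>a. a \<in> insert q (poly.coeff f ` {2..}) \<Longrightarrow> n dvd a"
    "\<And>h. (\<And>a. a \<in> insert q (poly.coeff f ` {2..}) \<Longrightarrow> h dvd a) \<Longrightarrow> h dvd n"
    using pid_gcd[OF pid, of "insert q (poly.coeff f ` {2..})"] by blast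
  have "p dvd n" if "prime_elem p" "p dvd q" for p
    using n(2)[of p] that nil by auto
  then obtain m where "q dvd n ^ m" using pid_dvd_power[OF pid \<open>q \<noteq> 0\<close>] by metis
  then show ?thesis using v n(1) by (intro unit_nilpotent_VA1[of q v f n m]) auto
qed

subsection \<open>Degrees modulo a prime\<close>

text \<open>\<open>reduce p f\<close> drops the coefficients divisible by \<open>p\<close>; its degree is the degree of the
  image of \<open>f\<close> over the domain of residues modulo \<open>p\<close>.\<close>

definition reduce :: "'a :: idom \<Rightarrow> 'a poly \<Rightarrow> 'a poly" where
  "reduce p f = map_poly (\<lambda>c. if p dvd c then 0 else c) f"

lemma coeff_reduce: "poly.coeff (reduce p f) k = (if p dvd poly.coeff f k then 0 else poly.coeff f k)"
  by (simp add: reduce_def coeff_map_poly)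

lemma reduce_cong: "[:p:] dvd f - reduce p f"
  by (auto simp: const_poly_dvd_iff coeff_reduce)

lemma reduce_eq_0_iff: "reduce p f = 0 \<longleftrightarrow> [:p:] dvd f"
  by (auto simp: poly_eq_iff coeff_reduce const_poly_dvd_iff)

lemma lead_coeff_reduce: "reduce p f \<noteq> 0 \<Longrightarrow> \<not> p dvd lead_coeff (reduce p f)"
  by (metis coeff_reduce leading_coeff_0_iff)

lemma reduce_degree_0_cong: "Polynomial.degree (reduce p f) = 0 \<Longrightarrow> [:p:] dvd f - [:poly.coeff f 0:]"
proof -
  assume "Polynomial.degree (reduce p f) = 0"
  then have "poly.coeff (reduce p f) k = 0" if "k > 0" for k
    using that by (intro coeff_eq_0) simp
  then have "p dvd poly.coeff f k" if "k > 0" for k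
    using that by (metis coeff_reduce dvd_0_right)
  then have "p dvd poly.coeff (f - [:poly.coeff f 0:]) k" for k
    by (cases k) simp_all
  then show ?thesis by (simp add: const_poly_dvd_iff)
qed

text \<open>Degrees multiply under composition over the domain of residues modulo \<open>p\<close>.
  The index is the degree of the composition of the reductions, whose leading coefficient is a
  product of elements not divisible by \<open>p\<close>.\<close>

lemma coeff_pcompose_not_dvd:
  fixes f g :: "'a :: idom poly"
  assumes p: "prime_elem p" and "reduce p f \<noteq> 0" "Polynomial.degree (reduce p g) > 0"
  shows "\<not> p dvd poly.coeff (pcompose f g)
    (Polynomial.degree (reduce p f) * Polynomial.degree (reduce p g))"
proof -
  let ?f = "reduce p f" and ?g = "reduce p g"
  have "?g \<noteq> 0" using assms(3) by auto
  have "poly.coeff (pcompose ?f ?g) (Polynomial.degree ?f * Polynomial.degree ?g) =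
      lead_coeff ?f * lead_coeff ?g ^ Polynomial.degree ?f"
    using lead_coeff_comp[OF assms(3), of ?f] by (simp add: degree_pcompose)
  then have *: "\<not> p dvd poly.coeff (pcompose ?f ?g) (Polynomial.degree ?f * Polynomial.degree ?g)"
    using p lead_coeff_reduce[OF \<open>?g \<noteq> 0\<close>] lead_coeff_reduce[OF assms(2)]
    by (auto simp: prime_elem_dvd_mult_iff dest: prime_elem_dvd_power)
  have "[:p:] dvd pcompose f g - pcompose ?f ?g"
    by (rule cong_trans[OF pcompose_cong_left pcompose_cong_right]) (rule reduce_cong)+
  then have "p dvd poly.coeff (pcompose f g) k - poly.coeff (pcompose ?f ?g) k" for k
    by (simp add: const_poly_dvd_iff)
  then show ?thesis using * by (metis dvd_add_right_iff diff_add_cancel)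
qed

text \<open>Composing a nonzero polynomial with a non-constant one over a domain cannot give zero;
  here this is read modulo \<open>p\<close>.\<close>

lemma pcompose_dvdD:
  fixes f g :: "'a :: idom poly"
  assumes p: "prime_elem p" and "[:p:] dvd pcompose f g" "\<not> [:p:] dvd g - [:poly.coeff g 0:]"
  shows "[:p:] dvd f"
  using coeff_pcompose_not_dvd[of p f g] assms reduce_degree_0_cong[of p g]
  unfolding reduce_eq_0_iff by (auto simp: const_poly_dvd_iff[of p "pcompose f g"])

subsection \<open>Substitution into bivariate polynomials\<close>

lemma subst2_0 [simp]: "subst2 0 W = 0"
  by (simp add: subst2_def)

lemma subst2_pCons [simp]: "subst2 (pCons a Q) W = const2 a + W * subst2 Q W"
  by (simp add: subst2_def map_poly_pCons const2_def)

text \<open>This places \<open>f\<close> in the outer variable, so that \<open>subst2\<close>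
  becomes an ordinary composition over the base ring \<open>'a poly\<close> and the results on
  \<open>pcompose\<close> apply to it.\<close>

definition lift_y :: "'a :: comm_ring_1 poly \<Rightarrow> 'a poly poly" where
  "lift_y f = map_poly (\<lambda>c. [:c:]) f"

lemma coeff_lift_y [simp]: "poly.coeff (lift_y f) k = [:poly.coeff f k:]"
  by (simp add: lift_y_def coeff_map_poly)

lemma subst2_conv_pcompose: "subst2 f W = pcompose (lift_y f) W"
  by (induction f) (simp_all add: lift_y_def map_poly_pCons pcompose_pCons const2_def)

lemma subst2_const: "subst2 f [:P:] = [:pcompose f P:]"
  by (induction f) (simp_all add: pcompose_pCons const2_def)

lemma const2_add: "const2 (a + b) = const2 a + const2 b"
  by (simp add: const2_def)

lemma const2_mult: "const2 (a * b) = const2 a * const2 b"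
  by (simp add: const2_def)

lemma const2_0 [simp]: "const2 0 = 0"
  by (simp add: const2_def)

lemma const2_1 [simp]: "const2 1 = 1"
  by (simp add: const2_def one_pCons)

lemma subst2_add: "subst2 (f + g) W = subst2 f W + subst2 g W"
  by (induction f g rule: poly_induct2) (simp_all add: const2_add algebra_simps)

lemma subst2_smult: "subst2 (smult c f) W = const2 c * subst2 f W"
  by (induction f) (simp_all add: const2_mult algebra_simps)

lemma subst2_mult: "subst2 (f * g) W = subst2 f W * subst2 g W"
  by (induction f) (simp_all add: subst2_add subst2_smult algebra_simps)

lemma subst2_pcompose: "subst2 (pcompose f g) W = subst2 f (subst2 g W)"
  by (induction f) (simp_all add: pcompose_pCons subst2_add subst2_mult)

lemma reduce_lift_y: "reduce [:p:] (lift_y f) = lift_y (reduce p f)"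
  by (auto simp: poly_eq_iff coeff_reduce)

lemma degree_lift_y [simp]: "Polynomial.degree (lift_y f) = Polynomial.degree f"
  unfolding lift_y_def by (rule degree_map_poly) simp

lemma lift_y_dvd_iff: "[:[:p:]:] dvd lift_y f \<longleftrightarrow> [:p:] dvd (f :: 'a :: idom poly)"
  unfolding const_poly_dvd_iff[of "[:p:]" "lift_y f"] coeff_lift_y const_poly_dvd_const_poly_iff
    const_poly_dvd_iff[of p f] ..

text \<open>The degree argument in \<open>x\<close> forces \<open>Z\<close> to be univariate modulo \<open>p\<close>, after which the degree
  in \<open>y\<close> is multiplicative and equals \<open>1\<close>.\<close>

lemma linear_mod_prime:
  fixes f :: "'a :: idom poly"
  assumes p: "prime_elem p" and c: "\<not> p dvd c"
    and cong: "const2 p dvd subst2 f Z - const2 c * Y2"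
  shows "\<not> p dvd poly.coeff f 1" "\<And>k. k \<ge> 2 \<Longrightarrow> p dvd poly.coeff f k"
proof -
  \<comment> \<open>The degree count in \<open>x\<close> takes place over the base ring
    \<open>'a poly\<close>, where the prime is \<open>[:p:]\<close>.\<close>
  have p': "prime_elem [:p:]" using p by (simp add: prime_elem_const_poly_iff)
  let ?m = "Polynomial.degree (reduce p f)"
  have cY: "const2 c * Y2 = [:[:0, c:]:]" by (simp add: const2_def Y2_def)
  have nonconst: "\<not> [:p:] dvd [:a:] - [:0, c:]" for a
  proof
    assume "[:p:] dvd [:a:] - [:0, c:]"
    then have "p dvd poly.coeff ([:a:] - [:0, c:]) 1" unfolding const_poly_dvd_iff ..
    then show False using c by simp
  qed
  have coeff_cong: "[:p:] dvd poly.coeff (subst2 f Z) k - poly.coeff [:[:0, c:]:] k" for k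
    using cong unfolding cY unfolding const2_def const_poly_dvd_iff[of "[:p:]"] by simp
  \<comment> \<open>If \<open>f\<close> were constant modulo \<open>p\<close>, so would be
    \<open>f(Z)\<close>, whereas \<open>c y\<close> is not.\<close>
  have m: "?m > 0"
  proof (rule ccontr)
    assume "\<not> ?m > 0"
    then have "[:[:p:]:] dvd lift_y (f - [:poly.coeff f 0:])"
      unfolding lift_y_dvd_iff by (intro reduce_degree_0_cong) simp
    also have "lift_y (f - [:poly.coeff f 0:]) = lift_y f - lift_y [:poly.coeff f 0:]"
      by (simp add: poly_eq_iff)
    finally have "[:[:p:]:] dvd subst2 f Z - subst2 [:poly.coeff f 0:] Z"
      unfolding subst2_conv_pcompose by (rule pcompose_cong_left)
    then have "[:p:] dvd poly.coeff (subst2 f Z - subst2 [:poly.coeff f 0:] Z) 0"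
      unfolding const_poly_dvd_iff[of "[:p:]"] ..
    then have "[:p:] dvd poly.coeff (subst2 f Z) 0 - [:poly.coeff f 0:]" by (simp add: const2_def)
    from cong_trans[OF cong_sym[OF this] coeff_cong[of 0]] show False using nonconst by simp
  qed
  then have f: "reduce p f \<noteq> 0" by auto
  have Z: "Polynomial.degree (reduce [:p:] Z) = 0"
  proof (rule ccontr)
    assume "Polynomial.degree (reduce [:p:] Z) \<noteq> 0"
    then have n: "Polynomial.degree (reduce [:p:] Z) > 0" by simp
    have "reduce [:p:] (lift_y f) \<noteq> 0"
      using f lift_y_dvd_iff[of p f] by (simp add: reduce_eq_0_iff)
    from coeff_pcompose_not_dvd[OF p' this n]
    have "\<not> [:p:] dvd poly.coeff (subst2 f Z) (?m * Polynomial.degree (reduce [:p:] Z))"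
      by (simp add: subst2_conv_pcompose reduce_lift_y)
    moreover obtain j where "?m * Polynomial.degree (reduce [:p:] Z) = Suc j"
      using m n by (metis gr0_conv_Suc nat_0_less_mult_iff)
    ultimately show False using coeff_cong[of "Suc j"] by simp
  qed
  define z where "z = poly.coeff Z 0"
  have "[:[:p:]:] dvd subst2 f Z - subst2 f [:z:]"
    unfolding subst2_conv_pcompose z_def by (intro pcompose_cong_right reduce_degree_0_cong Z)
  then have "[:p:] dvd poly.coeff (subst2 f Z - subst2 f [:z:]) 0"
    unfolding const_poly_dvd_iff[of "[:p:]"] ..
  then have "[:p:] dvd poly.coeff (subst2 f Z) 0 - pcompose f z" by (simp add: subst2_const)
  from cong_trans[OF cong_sym[OF this] coeff_cong[of 0]]
  have fz: "[:p:] dvd pcompose f z - [:0, c:]" by simp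
  have l: "Polynomial.degree (reduce p z) > 0"
  proof (rule ccontr)
    assume "\<not> ?thesis"
    then have "[:p:] dvd pcompose f z - pcompose f [:poly.coeff z 0:]"
      by (intro pcompose_cong_right reduce_degree_0_cong) simp
    from cong_trans[OF cong_sym[OF this] fz] show False
      using nonconst by (simp add: pcompose_pCons_0)
  qed
  let ?k = "?m * Polynomial.degree (reduce p z)"
  have "p dvd poly.coeff (pcompose f z - [:0, c:]) ?k" using fz unfolding const_poly_dvd_iff ..
  then have "\<not> p dvd poly.coeff [:0, c:] ?k"
    using coeff_pcompose_not_dvd[OF p f l] by (metis coeff_diff diff_add_cancel dvd_add_left_iff)
  \<comment> \<open>Modulo \<open>p\<close> the only nonzero coefficient of \<open>c y\<close> sits
    at index 1, so the product of the two degrees is 1.\<close>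
  then have "?k = 1" by (cases ?k) (auto simp: coeff_pCons split: nat.splits)
  then have m1: "?m = 1" by simp
  then show "\<not> p dvd poly.coeff f 1" using lead_coeff_reduce[OF f]
    by (auto simp: coeff_reduce split: if_splits)
  show "p dvd poly.coeff f k" if "k \<ge> 2" for k
    using coeff_eq_0[of "reduce p f" k] m1 that by (simp add: coeff_reduce split: if_splits)
qed

subsection \<open>Passing to the fraction field\<close>

lemma fract2_add: "fract2 (F + G) = fract2 F + fract2 G"
  by (rule poly_eqI) (simp add: fract2_def coeff_map_poly)

lemma fract_poly_sum: "fract_poly (\<Sum>i\<in>A. f i) = (\<Sum>i\<in>A. fract_poly (f i))"
  by (induction A rule: infinite_finite_induct) simp_all

lemma fract2_mult: "fract2 (F * G) = fract2 F * fract2 G"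
  by (rule poly_eqI) (simp add: fract2_def coeff_map_poly coeff_mult fract_poly_sum)

lemma fract2_const2 [simp]: "fract2 (const2 a) = const2 (to_fract a)"
  by (simp add: fract2_def const2_def map_poly_pCons)

lemma fract2_X2 [simp]: "fract2 X2 = X2"
  by (simp add: fract2_def X2_def map_poly_pCons one_pCons)

lemma fract2_Y2 [simp]: "fract2 Y2 = Y2"
  by (simp add: fract2_def Y2_def map_poly_pCons)

lemma fract2_subst2: "fract2 (subst2 Q W) = subst2 (fract_poly Q) (fract2 W)"
proof (induction Q)
  case 0
  then show ?case by (simp add: fract2_def)
next
  case (pCons a Q)
  then show ?case by (simp add: map_poly_pCons fract2_add fract2_mult)
qed

lemma fract2_inject: "fract2 F = fract2 G \<Longrightarrow> F = G"
  by (simp add: fract2_def poly_eq_iff coeff_map_poly)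

lemma clear_denominators:
  fixes Q :: "'a :: idom fract poly"
  obtains e P where "e \<noteq> 0" "smult (to_fract e) Q = fract_poly P"
proof -
  have "\<exists>e P. e \<noteq> 0 \<and> smult (to_fract e) Q = fract_poly P"
  proof (induction Q)
    case 0
    show ?case by (intro exI[of _ 1] exI[of _ 0]) simp
  next
    case (pCons a Q)
    obtain e P where e: "e \<noteq> 0" "smult (to_fract e) Q = fract_poly P" using pCons.IH by blast
    obtain x y where a: "a = to_fract x / to_fract y" "y \<noteq> 0"
      by (cases a) (simp add: Fract_conv_to_fract)
    have "smult (to_fract (y * e)) (pCons a Q) = fract_poly (pCons (e * x) (smult y P))"
      using a e(2)[symmetric] by (simp add: map_poly_pCons field_simps)
    then show ?case using e(1) a(2) by (intro exI[of _ "y * e"]) auto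
  qed
  then show thesis using that by blast
qed

text \<open>After clearing denominators, the gcd \<open>g\<close> of the coefficients is split off.
  A prime \<open>p\<close> dividing the quotient would make \<open>p * g\<close> a common divisor,
  which would then divide \<open>g\<close>.\<close>

lemma primitive_multiple:
  fixes Q :: "'a :: idom fract poly"
  assumes pid: "is_pid TYPE('a)" and "Q \<noteq> 0"
  obtains c P where "Q = smult c (fract_poly P)" "\<And>p. prime_elem p \<Longrightarrow> \<not> [:p:] dvd P"
proof -
  obtain e P0 where e: "e \<noteq> 0" "smult (to_fract e) Q = fract_poly P0"
    using clear_denominators .
  have "P0 \<noteq> 0" using e \<open>Q \<noteq> 0\<close> by auto
  obtain g where g: "\<And>a. a \<in> range (poly.coeff P0) \<Longrightarrow> g dvd a"
    "\<And>h. (\<And>a. a \<in> range (poly.coeff P0) \<Longrightarrow> h dvd a) \<Longrightarrow> h dvd g"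
    using pid_gcd[OF pid, of "range (poly.coeff P0)"] by blast
  have "[:g:] dvd P0" using g(1) by (simp add: const_poly_dvd_iff)
  then obtain P where P: "P0 = [:g:] * P" by blast
  then have "g \<noteq> 0" using \<open>P0 \<noteq> 0\<close> by auto
  have "Q = smult (inverse (to_fract e)) (smult (to_fract e) Q)" using e(1) by simp
  also have "\<dots> = smult (to_fract g / to_fract e) (fract_poly P)"
    unfolding e(2) by (simp add: P field_simps)
  finally have "Q = smult (to_fract g / to_fract e) (fract_poly P)" .
  moreover have "\<not> [:p:] dvd P" if "prime_elem p" for p
  proof
    assume "[:p:] dvd P"
    then have "p * g dvd poly.coeff P0 k" for k
      by (simp add: P const_poly_dvd_iff mult.commute)
    then have "p * g dvd g" by (intro g(2)) auto
    then have "p * g dvd 1 * g" by simp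
    then have "p dvd 1" using \<open>g \<noteq> 0\<close> by (simp only: dvd_mult_cancel_right) simp
    then show False using that by (simp add: prime_elem_def)
  qed
  ultimately show thesis using that by blast
qed

subsection \<open>Length 2 polynomials over the base ring\<close>

text \<open>These are the first two Taylor coefficients in \<open>x\<close> of
  \<open>S(P + r x)\<close>.\<close>

lemma coeff_subst2_linear:
  "poly.coeff (subst2 S [:P, [:r:]:]) 0 = pcompose S P"
  "poly.coeff (subst2 S [:P, [:r:]:]) 1 = smult r (pcompose (pderiv S) P)"
  for S P :: "'a :: idom poly"
proof -
  show *: "poly.coeff (subst2 S [:P, [:r:]:]) 0 = pcompose S P" for S
    by (induction S) (simp_all add: pcompose_pCons const2_def)
  show "poly.coeff (subst2 S [:P, [:r:]:]) 1 = smult r (pcompose (pderiv S) P)"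
  proof (induction S)
    case (pCons a S)
    then show ?case using *[of S]
      by (simp add: pcompose_pCons const2_def pderiv_pCons pcompose_add smult_add_right)
  qed simp
qed

lemma linear_form_eq: "const2 r * X2 + subst2 P Y2 = [:P, [:r:]:]"
  by (simp add: const2_def X2_def Y2_def subst2_const)

text \<open>Two primitive multiples are taken: one normalizes the inner linear form, the other the
  whole relation, with the coefficient of \<open>F\<close> included.\<close>

lemma rational_length2_normal_form:
  fixes F :: "'a :: idom poly poly"
  assumes pid: "is_pid TYPE('a)" and len2: "rational_length2 F"
  obtains d q r :: 'a and P S :: "'a poly" where "d \<noteq> 0" "q \<noteq> 0" "r \<noteq> 0" "poly.coeff P 0 = 0"
    "const2 d * F = const2 q * Y2 + subst2 S [:P, [:r:]:]"
    "\<And>p. prime_elem p \<Longrightarrow> \<not> [:p:] dvd pCons r P"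
    "\<And>p. prime_elem p \<Longrightarrow> \<not> [:p:] dvd pCons d (pCons q S)"
proof -
  obtain p1 p2 :: "'a fract" and Q1 Q2 where p: "p1 \<noteq> 0" "p2 \<noteq> 0"
    and F: "fract2 F = const2 p2 * Y2 + subst2 Q2 (const2 p1 * X2 + subst2 Q1 Y2)"
    using len2 unfolding rational_length2_def by blast
  \<comment> \<open>Splitting off the constant term of \<open>Q1\<close> yields
    \<open>P(0) = 0\<close>; the outer polynomial absorbs it through the affine substitution
    \<open>[:a, c:]\<close>.\<close>
  define a where "a = poly.coeff Q1 0"
  \<comment> \<open>Here \<open>pCons\<close> only packs \<open>p1\<close> and the remaining
    coefficients into one list, so that a single scalar makes them jointly primitive.\<close>
  obtain c R where R: "pCons p1 (Q1 - [:a:]) = smult c (fract_poly R)"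
    and R_prim: "\<And>p. prime_elem p \<Longrightarrow> \<not> [:p:] dvd R"
    using primitive_multiple[OF pid, of "pCons p1 (Q1 - [:a:])"] p(1) by auto
  obtain r P where rP: "R = pCons r P" by (cases R)
  have p1: "p1 = c * to_fract r" and Q1: "Q1 - [:a:] = smult c (fract_poly P)"
    using R by (simp_all add: rP map_poly_pCons)
  have "c \<noteq> 0" "r \<noteq> 0" using p1 p(1) by auto
  have "c * to_fract (poly.coeff P 0) = poly.coeff (Q1 - [:a:]) 0"
    unfolding Q1 by (simp add: coeff_map_poly)
  then have P0: "poly.coeff P 0 = 0" using \<open>c \<noteq> 0\<close> by (simp add: a_def)
  define W where "W = [:P, [:r:]:]"
  have W: "fract2 W = [:fract_poly P, [:to_fract r:]:]"
    by (simp add: W_def fract2_def map_poly_pCons)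
  have "const2 p1 * X2 + subst2 Q1 Y2 = [:Q1, [:p1:]:]" by (rule linear_form_eq)
  also have "\<dots> = subst2 [:a, c:] (fract2 W)"
    using Q1 by (simp add: W p1 const2_def algebra_simps)
  finally have F': "fract2 F = const2 p2 * Y2 + subst2 (pcompose Q2 [:a, c:]) (fract2 W)"
    using F by (simp add: subst2_pcompose)
  \<comment> \<open>The entry 1 stands for the coefficient of \<open>F\<close>; its multiple is the
    denominator \<open>d\<close>, with \<open>k\<close> the inverse of \<open>d\<close>.\<close>
  obtain k T where T: "pCons 1 (pCons p2 (pcompose Q2 [:a, c:])) = smult k (fract_poly T)"
    and T_prim: "\<And>p. prime_elem p \<Longrightarrow> \<not> [:p:] dvd T"
    using primitive_multiple[OF pid, of "pCons 1 (pCons p2 (pcompose Q2 [:a, c:]))"] by auto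
  obtain d q S where dqS: "T = pCons d (pCons q S)" by (metis pCons_cases)
  have k: "k * to_fract d = 1" "p2 = k * to_fract q" "pcompose Q2 [:a, c:] = smult k (fract_poly S)"
    using T by (simp_all add: dqS map_poly_pCons)
  have "d \<noteq> 0" "q \<noteq> 0" using k p(2) by auto
  have "fract2 (const2 d * F) = (const2 (to_fract d) * const2 k) *
      (const2 (to_fract q) * Y2 + subst2 (fract_poly S) (fract2 W))"
    by (simp add: fract2_mult F' k subst2_smult const2_mult algebra_simps)
  also have "const2 (to_fract d) * const2 k = 1"
    using k(1) by (simp add: mult.commute flip: const2_mult)
  also have "1 * (const2 (to_fract q) * Y2 + subst2 (fract_poly S) (fract2 W)) =
      fract2 (const2 q * Y2 + subst2 S W)"
    by (simp add: fract2_mult fract2_add fract2_subst2)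
  finally have "const2 d * F = const2 q * Y2 + subst2 S W" by (rule fract2_inject)
  then show thesis
    using that \<open>d \<noteq> 0\<close> \<open>q \<noteq> 0\<close> \<open>r \<noteq> 0\<close> P0 R_prim T_prim by (simp add: W_def rP dqS)
qed

text \<open>The inner form \<open>P + r x\<close> is non-constant modulo \<open>p\<close>. If
  \<open>p\<close> divides \<open>r\<close>, then \<open>P\<close> is nonzero modulo
  \<open>p\<close> with \<open>P(0) = 0\<close>, and setting \<open>x = 0\<close> suffices;
  otherwise the form has positive degree in \<open>x\<close> over \<open>'a poly\<close>.\<close>

lemma const2_dvd_linear_subst2D:
  fixes P S :: "'a :: idom poly"
  assumes p: "prime_elem p" and dvd: "const2 p dvd subst2 S [:P, [:r:]:]"
    and P: "poly.coeff P 0 = 0" "\<not> [:p:] dvd pCons r P"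
  shows "[:p:] dvd S"
proof (cases "p dvd r")
  case True
  have "[:p:] dvd poly.coeff (subst2 S [:P, [:r:]:]) 0"
    using dvd unfolding const2_def const_poly_dvd_iff[of "[:p:]"] ..
  then have "[:p:] dvd pcompose S P" by (simp only: coeff_subst2_linear)
  moreover have "\<not> [:p:] dvd P"
  proof
    assume "[:p:] dvd P"
    then have "p dvd poly.coeff (pCons r P) n" for n
      using True by (cases n) (simp_all add: const_poly_dvd_iff)
    then show False using P(2) by (simp add: const_poly_dvd_iff)
  qed
  then have "\<not> [:p:] dvd P - [:poly.coeff P 0:]" by (simp add: P(1))
  ultimately show ?thesis by (rule pcompose_dvdD[OF p])
next
  case False
  have "\<not> [:[:p:]:] dvd [:P, [:r:]:] - [:poly.coeff [:P, [:r:]:] 0:]"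
  proof
    assume "[:[:p:]:] dvd [:P, [:r:]:] - [:poly.coeff [:P, [:r:]:] 0:]"
    then have "[:p:] dvd poly.coeff ([:P, [:r:]:] - [:poly.coeff [:P, [:r:]:] 0:]) 1"
      unfolding const_poly_dvd_iff[of "[:p:]"] ..
    then show False using False by simp
  qed
  then show ?thesis
    using pcompose_dvdD[of "[:p:]" "lift_y S" "[:P, [:r:]:]"] p dvd
    by (simp add: prime_elem_const_poly_iff subst2_conv_pcompose const2_def lift_y_dvd_iff)
qed

text \<open>With \<open>F0\<close>, \<open>F1\<close> the coefficients of \<open>F\<close> at
  \<open>x ^ 0\<close> and \<open>x ^ 1\<close>, \<open>d F0 = q y + S(P)\<close> and
  \<open>d F1 = r S'(P)\<close>. Differentiating the first and multiplying by \<open>r\<close> gives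
  \<open>r q = d (r F0' - F1 P')\<close>; Bezout then removes \<open>q\<close>.\<close>

lemma dvd_linear_coeff:
  fixes F :: "'a :: idom poly poly"
  assumes F: "const2 d * F = const2 q * Y2 + subst2 S [:P, [:r:]:]"
    and bezout: "d * u + q * v = 1"
  shows "d dvd r"
proof -
  have F0: "smult d (poly.coeff F 0) = [:0, q:] + pcompose S P"
    using arg_cong[OF F, of "\<lambda>G. poly.coeff G 0"]
    by (simp add: coeff_subst2_linear) (simp add: const2_def Y2_def)
  have F1: "smult d (poly.coeff F 1) = smult r (pcompose (pderiv S) P)"
    using arg_cong[OF F, of "\<lambda>G. poly.coeff G 1"]
    by (simp add: coeff_subst2_linear[unfolded One_nat_def]) (simp add: const2_def Y2_def)
  have "smult d (smult r (pderiv (poly.coeff F 0))) =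
      smult r (pderiv (smult d (poly.coeff F 0)))"
    by (simp add: pderiv_smult mult.commute)
  also have "\<dots> = [:r * q:] + smult r (pcompose (pderiv S) P) * pderiv P"
    by (simp add: F0 pderiv_add pderiv_pCons pderiv_pcompose smult_add_right)
  also have "\<dots> = [:r * q:] + smult d (poly.coeff F 1 * pderiv P)"
    by (simp flip: F1)
  finally have "[:r * q:] =
      smult d (smult r (pderiv (poly.coeff F 0)) - poly.coeff F 1 * pderiv P)"
    by (simp add: smult_diff_right)
  then have "r * q = d * poly.coeff (smult r (pderiv (poly.coeff F 0)) - poly.coeff F 1 * pderiv P) 0"
    by (metis coeff_pCons_0 coeff_smult)
  then have "d dvd r * q" by (metis dvd_triv_left)
  then have "d dvd d * (u * r) + (r * q) * v" by simp
  also have "d * (u * r) + (r * q) * v = r * (d * u + q * v)" by (simp add: algebra_simps)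
  finally show ?thesis by (simp add: bezout)
qed

text \<open>The difference \<open>S(P + q1 d x) - S(P)\<close> is divisible by \<open>q1 d x\<close>
  and equals \<open>d (F - F(0,y))\<close>; cancelling \<open>d\<close> leaves the divisor
  \<open>q1 x\<close>.\<close>

lemma const2_dvd_minus_constant_coeff:
  fixes F :: "'a :: idom poly poly"
  assumes F: "const2 d * F = const2 q * Y2 + subst2 S [:P, [:q1 * d:]:]" and "d \<noteq> 0"
  shows "const2 q1 dvd F - [:poly.coeff F 0:]"
proof -
  have F0: "smult d (poly.coeff F 0) = [:0, q:] + pcompose S P"
    using arg_cong[OF F, of "\<lambda>G. poly.coeff G 0"]
    by (simp add: coeff_subst2_linear) (simp add: const2_def Y2_def)
  have "const2 d * [:poly.coeff F 0:] = const2 q * Y2 + subst2 S [:P:]"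
    using F0 by (simp add: const2_def Y2_def subst2_const)
  then have "const2 d * (F - [:poly.coeff F 0:]) = subst2 S [:P, [:q1 * d:]:] - subst2 S [:P:]"
    using F by (simp add: right_diff_distrib)
  moreover have "[:P, [:q1 * d:]:] - [:P:] dvd subst2 S [:P, [:q1 * d:]:] - subst2 S [:P:]"
    unfolding subst2_def by (rule poly_diff_dvd)
  moreover have "[:P, [:q1 * d:]:] - [:P:] = const2 d * (const2 q1 * X2)"
    by (simp add: const2_def X2_def mult.commute)
  ultimately have "const2 d * (const2 q1 * X2) dvd const2 d * (F - [:poly.coeff F 0:])" by metis
  moreover have "const2 d \<noteq> 0" using \<open>d \<noteq> 0\<close> by (simp add: const2_def)
  ultimately have "const2 q1 * X2 dvd F - [:poly.coeff F 0:]" by simp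
  then show ?thesis by (rule dvd_mult_left)
qed

text \<open>The map is the inverse of an automorphism sending \<open>y\<close> to \<open>F\<close>;
  only its homomorphism properties are kept.\<close>

lemma VA2_retraction:
  fixes F :: "'a :: idom poly poly"
  assumes "F \<in> VA2"
  obtains \<tau> where "\<And>G H. \<tau> (G + H) = \<tau> G + \<tau> H" "\<And>G H. \<tau> (G * H) = \<tau> G * \<tau> H"
    "\<And>c. \<tau> (const2 c) = const2 c" "\<tau> F = Y2"
proof -
  obtain \<sigma> where \<sigma>: "\<sigma> \<in> GA2" "\<sigma> Y2 = F" using assms by (auto simp: VA2_def)
  have hom: "\<sigma> (G + H) = \<sigma> G + \<sigma> H" "\<sigma> (G * H) = \<sigma> G * \<sigma> H" for G H
    using \<sigma>(1) ring_hom_add[of \<sigma> ring_of_type_algebra ring_of_type_algebra G H]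
      ring_hom_mult[of \<sigma> ring_of_type_algebra ring_of_type_algebra G H]
    by (auto simp: GA2_def alg_aut_def ring_iso_def)
  have const: "\<sigma> (const2 c) = const2 c" for c using \<sigma>(1) by (auto simp: GA2_def alg_aut_def)
  have bij: "bij \<sigma>" using \<sigma>(1) by (auto simp: GA2_def alg_aut_def ring_iso_def)
  have surj: "\<sigma> (inv_into UNIV \<sigma> G) = G" for G
    using bij by (simp add: bij_is_surj surj_f_inv_f)
  have eqI: "G = H" if "\<sigma> G = \<sigma> H" for G H using bij that by (meson bij_is_inj injD)
  show thesis
    \<comment> \<open>Each identity is checked after applying the injective map
      \<open>\<sigma>\<close>.\<close>
    by (rule that[of "inv_into UNIV \<sigma>"]; rule eqI; simp add: surj hom const \<sigma>(2))
qed

theorem theorem7: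
  fixes F :: "'a::idom poly poly"
  assumes pid: "principal_domain (ring_of_type_algebra :: 'a ring)"
    and coord: "F \<in> VA2"
    and len2: "rational_length2 F"
  shows "\<exists>(d::'a) (q1::'a) (q2::'a) (Q1::'a poly) (Q2::'a poly).
    d \<noteq> 0 \<and> q1 \<noteq> 0 \<and> q2 \<noteq> 0 \<and>
    {d * a + q2 * b | a b. True} = UNIV \<and>
    phi d (smult q2 [:0, 1:] + pcompose Q2 Q1) = \<zero>\<^bsub>UP (resring d)\<^esub> \<and>
    fract2 F = const2 (inverse (to_fract d)) *
      fract2 (const2 q2 * Y2 + subst2 Q2 (const2 (q1 * d) * X2 + subst2 Q1 Y2)) \<and>
    phi q1 (poly F 0) \<in> VA1 (resring q1) \<and>
    phi q2 Q2 \<in> VA1 (resring q2)"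
proof -
  have is_pid: "is_pid TYPE('a)" using pid by (simp add: is_pid_def)
  obtain d q r :: 'a and P S :: "'a poly" where nz: "d \<noteq> 0" "q \<noteq> 0" "r \<noteq> 0"
    and P0: "poly.coeff P 0 = 0"
    and F: "const2 d * F = const2 q * Y2 + subst2 S [:P, [:r:]:]"
    and rP: "\<And>p. prime_elem p \<Longrightarrow> \<not> [:p:] dvd pCons r P"
    and dqS: "\<And>p. prime_elem p \<Longrightarrow> \<not> [:p:] dvd pCons d (pCons q S)"
    using rational_length2_normal_form[OF is_pid len2] by metis
  \<comment> \<open>A common prime of \<open>d\<close> and \<open>q\<close> would divide
    \<open>S(W)\<close>, hence \<open>S\<close>, against the joint primitivity of \<open>d\<close>,
    \<open>q\<close> and \<open>S\<close>.\<close>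
  have coprime: "False" if p: "prime_elem p" "p dvd d" "p dvd q" for p
  proof -
    have "const2 p dvd const2 d * F - const2 q * Y2"
      using p by (auto simp: const2_mult elim!: dvdE intro!: dvd_diff dvd_mult2)
    then have "const2 p dvd subst2 S [:P, [:r:]:]" unfolding F by simp
    then have "[:p:] dvd S" by (rule const2_dvd_linear_subst2D[OF p(1) _ P0 rP[OF p(1)]])
    then have "[:p:] dvd pCons d (pCons q S)"
      using p by (auto simp: const_poly_dvd_iff coeff_pCons split: nat.splits)
    then show False using dqS[OF p(1)] by simp
  qed
  obtain u v where bezout: "d * u + q * v = 1" using pid_bezout[OF is_pid nz(1) coprime] .
  obtain q1 where q1: "r = q1 * d" using dvd_linear_coeff[OF F bezout] by (metis dvdE mult.commute)
  have "q1 \<noteq> 0" using q1 nz by auto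
  obtain \<tau> where \<tau>: "\<And>G H. \<tau> (G + H) = \<tau> G + \<tau> H" "\<And>G H. \<tau> (G * H) = \<tau> G * \<tau> H"
    "\<And>c. \<tau> (const2 c) = const2 c" "\<tau> F = Y2"
    using VA2_retraction[OF coord] by metis
  have \<tau>_0: "\<tau> 0 = 0" using \<tau>(3)[of 0] by simp
  have \<tau>_subst: "\<tau> (subst2 f W) = subst2 f (\<tau> W)" for f W
    by (induction f) (simp_all add: \<tau> \<tau>_0)
  have unit: "{d * a + q * b | a b. True} = UNIV"
  proof -
    have "c = d * (u * c) + q * (v * c)" for c
      using arg_cong[OF bezout, of "\<lambda>x. x * c"] by (simp add: algebra_simps)
    then show ?thesis by blast
  qed
  have "smult d (poly.coeff F 0) = smult q [:0, 1:] + pcompose S P"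
    using arg_cong[OF F, of "\<lambda>G. poly.coeff G 0"]
    by (simp add: coeff_subst2_linear) (simp add: const2_def Y2_def)
  \<comment> \<open>The subtracted \<open>0\<close> brings the divisibility into the form of
    \<open>phi_eq_iff\<close>.\<close>
  then have "[:d:] dvd smult q [:0, 1:] + pcompose S P - 0"
    by (metis diff_zero smult_dvd_cancel dvd_refl const_poly_dvd_iff coeff_smult dvd_triv_left)
  then have mod_d: "phi d (smult q [:0, 1:] + pcompose S P) = \<zero>\<^bsub>UP (resring d)\<^esub>"
    unfolding phi_0[symmetric] phi_eq_iff .
  have "const2 (inverse (to_fract d)) * fract2 (const2 d * F) = fract2 F"
    using nz(1) by (simp add: fract2_mult mult.assoc[symmetric] flip: const2_mult)
  then have eq: "fract2 F = const2 (inverse (to_fract d)) *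
      fract2 (const2 q * Y2 + subst2 S (const2 (q1 * d) * X2 + subst2 P Y2))"
    unfolding linear_form_eq using F q1 by simp
  have VA1_F: "phi q1 (poly F 0) \<in> VA1 (resring q1)"
  proof -
    \<comment> \<open>Modulo \<open>p\<close>, \<open>F\<close> equals \<open>F(0,y)\<close>;
      applying \<open>\<tau>\<close> gives the hypothesis of \<open>linear_mod_prime\<close> with
      \<open>c = 1\<close> and \<open>Z = \<tau> Y2\<close>.\<close>
    have "const2 p dvd subst2 (poly.coeff F 0) (\<tau> Y2) - const2 1 * Y2"
      if "prime_elem p" "p dvd q1" for p
    proof -
      have "const2 p dvd const2 q1" using that(2) by (simp add: const2_def)
      also have "const2 q1 dvd F - [:poly.coeff F 0:]"
        using F nz(1) unfolding q1 by (rule const2_dvd_minus_constant_coeff)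
      finally obtain G where "F - [:poly.coeff F 0:] = const2 p * G" by blast
      then have "F = subst2 (poly.coeff F 0) Y2 + const2 p * G"
        by (simp add: Y2_def subst2_const algebra_simps)
      then have "\<tau> F = subst2 (poly.coeff F 0) (\<tau> Y2) + const2 p * \<tau> G"
        by (metis \<tau>(1-3) \<tau>_subst)
      then have "subst2 (poly.coeff F 0) (\<tau> Y2) - \<tau> F = const2 p * (- \<tau> G)" by simp
      then have "const2 p dvd subst2 (poly.coeff F 0) (\<tau> Y2) - \<tau> F" by (metis dvd_triv_left)
      then show ?thesis unfolding \<tau>(4) by simp
    qed
    from linear_mod_prime[OF _ _ this]
    have "phi q1 (poly.coeff F 0) \<in> VA1 (resring q1)"
      using \<open>q1 \<noteq> 0\<close> by (intro VA1_of_prime_coeffs[OF is_pid]) (auto simp: prime_elem_def)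
    then show ?thesis by (simp add: poly_0_coeff_0)
  qed
  have VA1_S: "phi q S \<in> VA1 (resring q)"
  proof -
    \<comment> \<open>Applying \<open>\<tau>\<close> to the relation for \<open>d F\<close> kills
      the \<open>q\<close> term modulo \<open>p\<close>. Now \<open>c = d\<close>, which
      \<open>p\<close> does not divide by coprimality.\<close>
    have "const2 p dvd subst2 S (\<tau> [:P, [:r:]:]) - const2 d * Y2"
      if "prime_elem p" "p dvd q" for p
    proof -
      have "const2 d * Y2 = \<tau> (const2 d * F)" by (simp add: \<tau>)
      also have "\<dots> = const2 q * \<tau> Y2 + subst2 S (\<tau> [:P, [:r:]:])"
        unfolding F by (simp add: \<tau> \<tau>_subst)
      finally have "subst2 S (\<tau> [:P, [:r:]:]) - const2 d * Y2 = const2 q * (- \<tau> Y2)" by simp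
      moreover have "const2 p dvd const2 q" using that(2) by (simp add: const2_def)
      ultimately show ?thesis by (metis dvd_mult2)
    qed
    from linear_mod_prime[OF _ _ this]
    show ?thesis using nz(2) coprime by (intro VA1_of_prime_coeffs[OF is_pid]) blast+
  qed
  show ?thesis
    using nz(1,2) \<open>q1 \<noteq> 0\<close> unit mod_d eq VA1_F VA1_S
    by (intro exI[of _ d] exI[of _ q1] exI[of _ q] exI[of _ P] exI[of _ S] conjI)
qed

end
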